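(* (i) $(\mathcal{F},\tau_{\operatorname{St}})$ is not Hausdorff but is preregular. (ii) $(\mathbb{R}^{\mathbb{Z}_{<}},\tau_v)$ is Hausdorff, first-countable, zero-dimensional, spherically complete (with respect to the ultrametric $d$), not locally compact, and not second-countable.
   Context: $\mathbb{R}^{\mathbb{Z}_{<}}$ is the field of all two-sided real sequences $\mathbf{x}=(x_n)_{n\in\mathbb{Z}}$ for which there exists $N$ with $x_n=0$ for all $n<-N$, with componentwise addition and Cauchy convolution $(\mathbf{x}\cdot\mathbf{y})_n=\sum_{k\in\mathbb{Z}}x_k y_{n-k}$. The valuation is $\operatorname{val}(\mathbf{x})=\min\{n:x_n\ne 0\}$, $\operatorname{val}(0)=\infty$. The field is totally ordered by: $\mathbf{x}<\mathbf{y}$ iff $\mathbf{x}\neq\mathbf{y}$ and $y_n-x_n>0$ for $n=\operatorname{val}(\mathbf{y}-\mathbf{x})$. Reals $r$ are identified with the sequence having $r$ at index $0$ and $0$ elsewhere. $\mathcal{F}$ is the set of finite elements, i.e. those $\mathbf{x}$ with $|\mathbf{x}|<r$ for some $r\in\mathbb{R}$, and $\operatorname{St}(\mathbf{x})=x_0$ for $\mathbf{x}\in\mathcal{F}$. The valuation topology $\tau_v$ on $\mathbb{R}^{\mathbb{Z}_{<}}$ is generated by the ultrametric $d(\mathbf{x},\mathbf{y})=2^{-\operatorname{val}(\mathbf{x}-\mathbf{y})}$ (with $2^{-\infty}=0$). The standard topology $\tau_{\operatorname{St}}$ on $\mathcal{F}$ is generated by the pseudo-metric $d_{\mathrm{st}}(\mathbf{x},\mathbf{y})=|\operatorname{St}(\mathbf{x})-\operatorname{St}(\mathbf{y})|$.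 A space is preregular if any two topologically distinguishable points have disjoint neighbourhoods; zero-dimensional if it has a base of clopen sets. An ultrametric space is spherically complete if every chain (under inclusion) of balls has nonempty intersection. *)

theory Defs
  imports "HOL-Analysis.Analysis" "HOL-Computational_Algebra.Formal_Laurent_Series"
begin

unbundle fps_syntax

text \<open>
  The field of two-sided real sequences vanishing below some index, with Cauchy convolution, is
  the library type \<^typ>\<open>real fls\<close>; \<^const>\<open>fls_subdegree\<close> is the valuation of a nonzero
  element (with the convention \<^prop>\<open>fls_subdegree (0 :: real fls) = 0\<close> instead of infinity, so zero is
  always treated separately), and a real \<open>r\<close> is identified with \<open>fls_const r\<close>.
\<close>

lemma fls_lead_add_pos:
  fixes f g :: "'a::linordered_field fls"
  assumes f: "f $$ fls_subdegree f > 0" and g: "g $$ fls_subdegree g > 0"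
  shows "(f + g) $$ fls_subdegree (f + g) > 0"
proof -
  define m where "m = min (fls_subdegree f) (fls_subdegree g)"
  have pos: "(f + g) $$ m > 0"
    using f g by (cases "fls_subdegree f" "fls_subdegree g" rule: linorder_cases)
      (auto simp: m_def)
  have "fls_subdegree (f + g) = m"
    by (rule fls_subdegree_eqI) (use pos in \<open>auto simp: m_def\<close>)
  with pos show ?thesis by simp
qed

lemma fls_lead_mult:
  fixes f g :: "'a::linordered_field fls"
  shows "(f * g) $$ fls_subdegree (f * g) = f $$ fls_subdegree f * g $$ fls_subdegree g"
  by (cases "f = 0 \<or> g = 0") (auto simp: fls_times_nth(2))

lemma fls_lead_uminus:
  fixes f :: "'a::linordered_field fls"
  shows "(- f) $$ fls_subdegree (- f) = - (f $$ fls_subdegree f)"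
  by simp

lemma fls_lead_diff_swap:
  fixes f g :: "'a::linordered_field fls"
  shows "(f - g) $$ fls_subdegree (f - g) = - ((g - f) $$ fls_subdegree (g - f))"
  using fls_lead_uminus[of "g - f"] by simp

instantiation fls :: (linordered_field) linordered_field
begin

definition less_fls :: "'a fls \<Rightarrow> 'a fls \<Rightarrow> bool"
  where "(x :: 'a fls) < y \<longleftrightarrow> x \<noteq> y \<and> (y - x) $$ fls_subdegree (y - x) > 0"

definition less_eq_fls :: "'a fls \<Rightarrow> 'a fls \<Rightarrow> bool"
  where "(x :: 'a fls) \<le> y \<longleftrightarrow> x = y \<or> x < y"

definition abs_fls :: "'a fls \<Rightarrow> 'a fls"
  where "\<bar>x :: 'a fls\<bar> = (if x < 0 then - x else x)"

definition sgn_fls :: "'a fls \<Rightarrow> 'a fls"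
  where "sgn (x :: 'a fls) = (if x = 0 then 0 else if 0 < x then 1 else - 1)"

instance
proof
  fix x y z :: "'a fls"
  have asym: "\<not> (u < v \<and> v < u)" for u v :: "'a fls"
    using fls_lead_diff_swap[of u v] by (auto simp: less_fls_def)
  have trans: "u < w" if "u < v" "v < w" for u v w :: "'a fls"
  proof -
    have "(w - u) $$ fls_subdegree (w - u) > 0"
      using fls_lead_add_pos[of "v - u" "w - v"] that by (simp add: less_fls_def)
    thus ?thesis by (auto simp: less_fls_def)
  qed
  show "(x < y) = (x \<le> y \<and> \<not> y \<le> x)"
    using asym[of x y] by (auto simp: less_eq_fls_def less_fls_def[of x x])
  show "x \<le> x" by (simp add: less_eq_fls_def)
  show "x \<le> z" if "x \<le> y" "y \<le> z" using that trans by (auto simp: less_eq_fls_def)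
  show "x = y" if "x \<le> y" "y \<le> x" using that asym[of x y] by (auto simp: less_eq_fls_def)
  show "x \<le> y \<or> y \<le> x"
  proof (cases "x = y")
    case False
    hence "(y - x) $$ fls_subdegree (y - x) \<noteq> 0" by (intro nth_fls_subdegree_nonzero) simp
    with False show ?thesis
      using fls_lead_diff_swap[of x y] by (auto simp: less_eq_fls_def less_fls_def)
  qed (simp add: less_eq_fls_def)
  show "z + x \<le> z + y" if "x \<le> y"
    using that by (auto simp: less_eq_fls_def less_fls_def)
  show "z * x < z * y" if "x < y" "0 < z"
  proof -
    have "(z * y - z * x) $$ fls_subdegree (z * y - z * x) > 0"
      using that fls_lead_mult[of z "y - x"] by (simp add: less_fls_def right_diff_distrib)
    thus ?thesis by (auto simp: less_fls_def)
  qed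
  show "\<bar>x\<bar> = (if x < 0 then - x else x)" by (rule abs_fls_def)
  show "sgn x = (if x = 0 then 0 else if 0 < x then 1 else - 1)" by (rule sgn_fls_def)
qed

end

definition finite_elements :: "real fls set" (\<open>\<F>\<close>)
  where "\<F> = {x. \<exists>r::real. \<bar>x\<bar> < fls_const r}"

definition St :: "real fls \<Rightarrow> real"
  where "St x = x $$ 0"

definition pseudometric_topology :: "'a set \<Rightarrow> ('a \<Rightarrow> 'a \<Rightarrow> real) \<Rightarrow> 'a topology"
  where "pseudometric_topology M d =
    topology (\<lambda>U. U \<subseteq> M \<and> (\<forall>x\<in>U. \<exists>r>0. {y \<in> M. d x y < r} \<subseteq> U))"

lemma openin_pseudometric_topology:
  "openin (pseudometric_topology M d) U \<longleftrightarrow>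
    U \<subseteq> M \<and> (\<forall>x\<in>U. \<exists>r>0. {y \<in> M. d x y < r} \<subseteq> U)"
proof -
  have "istopology (\<lambda>U. U \<subseteq> M \<and> (\<forall>x\<in>U. \<exists>r>0. {y \<in> M. d x y < r} \<subseteq> U))"
    unfolding istopology_def
  proof (intro conjI allI impI ballI)
    fix S T x
    assume S: "S \<subseteq> M \<and> (\<forall>x\<in>S. \<exists>r>0. {y \<in> M. d x y < r} \<subseteq> S)"
      and T: "T \<subseteq> M \<and> (\<forall>x\<in>T. \<exists>r>0. {y \<in> M. d x y < r} \<subseteq> T)"
    show "S \<inter> T \<subseteq> M" using S by blast
    assume "x \<in> S \<inter> T"
    then obtain r s where "r > 0" "{y \<in> M. d x y < r} \<subseteq> S" "s > 0" "{y \<in> M. d x y < s} \<subseteq> T"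
      using S T by blast
    thus "\<exists>r>0. {y \<in> M. d x y < r} \<subseteq> S \<inter> T"
      by (intro exI[of _ "min r s"]) auto
  next
    fix \<K>
    assume K: "\<forall>K\<in>\<K>. K \<subseteq> M \<and> (\<forall>x\<in>K. \<exists>r>0. {y \<in> M. d x y < r} \<subseteq> K)"
    show "\<Union>\<K> \<subseteq> M" using K by blast
    fix x assume "x \<in> \<Union>\<K>"
    then obtain C where "C \<in> \<K>" "x \<in> C" by blast
    with K obtain r where "r > 0" "{y \<in> M. d x y < r} \<subseteq> C" by blast
    with \<open>C \<in> \<K>\<close> show "\<exists>r>0. {y \<in> M. d x y < r} \<subseteq> \<Union>\<K>" by blast
  qed
  thus ?thesis by (simp add: pseudometric_topology_def topology_inverse')
qed

lemma topspace_pseudometric_topology [simp]: "topspace (pseudometric_topology M d) = M"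
proof -
  have "openin (pseudometric_topology M d) M"
    by (auto simp: openin_pseudometric_topology intro: exI[of _ 1])
  thus ?thesis
    by (meson openin_pseudometric_topology openin_subset openin_topspace subset_antisym)
qed

definition standard_topology :: "real fls topology" (\<open>\<tau>\<^sub>S\<^sub>t\<close>)
  where "\<tau>\<^sub>S\<^sub>t = pseudometric_topology \<F> (\<lambda>x y. \<bar>St x - St y\<bar>)"

text \<open>
  The metric that the library puts on formal Laurent series is the ultrametric
  \<open>2\<^bsup>-val(x-y)\<^esup>\<close>, as the following lemma confirms.
\<close>

lemma dist_fls_eq:
  fixes x y :: "real fls"
  shows "dist x y = (if x = y then 0 else 2 powi (- fls_subdegree (x - y)))"
  by (auto simp: dist_fls_def power_int_def power_one_over inverse_eq_divide)

definition valuation_metric :: "real fls metric"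
  where "valuation_metric = euclidean_metric"

definition valuation_topology :: "real fls topology" (\<open>\<tau>\<^sub>v\<close>)
  where "\<tau>\<^sub>v = mtopology_of valuation_metric"

definition preregular_space :: "'a topology \<Rightarrow> bool"
  where "preregular_space X \<longleftrightarrow>
    (\<forall>x\<in>topspace X. \<forall>y\<in>topspace X.
      (\<exists>W. openin X W \<and> (x \<in> W \<longleftrightarrow> y \<notin> W)) \<longrightarrow>
      (\<exists>U V. openin X U \<and> openin X V \<and> x \<in> U \<and> y \<in> V \<and> disjnt U V))"

definition zero_dimensional_space :: "'a topology \<Rightarrow> bool"
  where "zero_dimensional_space X \<longleftrightarrow>
    (\<exists>\<B>. (\<forall>V\<in>\<B>. openin X V \<and> closedin X V) \<and>
         (\<forall>U x. openin X U \<and> x \<in> U \<longrightarrow> (\<exists>V\<in>\<B>. x \<in> V \<and> V \<subseteq> U)))"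

definition ultrametric :: "'a metric \<Rightarrow> bool"
  where "ultrametric m \<longleftrightarrow>
    (\<forall>x\<in>mspace m. \<forall>y\<in>mspace m. \<forall>z\<in>mspace m.
      mdist m x z \<le> max (mdist m x y) (mdist m y z))"

text \<open>Balls are open or closed, and have positive radius.\<close>

definition metric_balls :: "'a metric \<Rightarrow> 'a set set"
  where "metric_balls m =
    {mball_of m x r | x r. x \<in> mspace m \<and> r > 0} \<union> {mcball_of m x r | x r. x \<in> mspace m \<and> r > 0}"

definition spherically_complete :: "'a metric \<Rightarrow> bool"
  where "spherically_complete m \<longleftrightarrow>
    ultrametric m \<and>
    (\<forall>\<C>. \<C> \<noteq> {} \<and> \<C> \<in> chains (metric_balls m) \<longrightarrow> \<Inter>\<C> \<noteq> {})"

end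

theory Submission
  imports Defs
begin

text \<open>
  All balls of the valuation metric, open or closed, are sets of sequences with prescribed entries
  below some index. A chain of such sets prescribes the entries consistently, so it has a common
  point. Since every real number may occur as the next entry, each ball splits into uncountably many
  disjoint open balls of equal radius, which rules out local compactness and second countability.

  Open sets of the standard topology are unions of fibres of \<open>St\<close>, so they cannot separate 0 from
  the infinitesimal \<open>fls_X\<close>, while points with different standard parts are separated as real
  numbers are.
\<close>

section \<open>Balls as sets of series with prescribed low entries\<close>

definition agree_below :: "int \<Rightarrow> 'a::zero fls \<Rightarrow> 'a fls set"
  where "agree_below n x = {y. \<forall>i<n. y $$ i = x $$ i}"

text \<open>The case \<open>x = y\<close> stands apart because \<open>fls_subdegree 0\<close> is 0
  rather than infinity.\<close>

lemma mem_agree_below_iff: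
  fixes x y :: "'a::group_add fls"
  shows "y \<in> agree_below n x \<longleftrightarrow> x = y \<or> n \<le> fls_subdegree (x - y)"
proof -
  have "y $$ i = x $$ i" if "i < fls_subdegree (x - y)" for i
    using fls_eq0_below_subdegree[OF that] by simp
  moreover have "n \<le> fls_subdegree (x - y)" if "x \<noteq> y" "\<forall>i<n. y $$ i = x $$ i"
    using that by (intro fls_subdegree_geI) auto
  ultimately show ?thesis
    unfolding agree_below_def mem_Collect_eq by (metis order_less_le_trans)
qed

lemma agree_below_refl [simp]: "x \<in> agree_below n x"
  by (simp add: agree_below_def)

lemma two_powi_eq_powr: "(2 :: real) powi m = 2 powr of_int m"
  by (rule powr_real_of_int' [symmetric]) auto

lemma log2_powi: "log 2 (2 powi m) = of_int m"
  unfolding two_powi_eq_powr by (rule log_powr_cancel) auto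

text \<open>Nonzero distances are integer powers of 2, so taking logarithms leaves an integer to
  compare with \<open>log 2 r\<close>, and the bound may be rounded down.\<close>

lemma fls_dist_le_iff:
  fixes x y :: "real fls"
  assumes "r > 0"
  shows "dist x y \<le> r \<longleftrightarrow> y \<in> agree_below (- \<lfloor>log 2 r\<rfloor>) x"
proof (cases "x = y")
  case False
  have "dist x y \<le> r \<longleftrightarrow> - fls_subdegree (x - y) \<le> \<lfloor>log 2 r\<rfloor>"
    unfolding le_floor_iff le_log_iff[OF _ assms, of 2, simplified]
    using False by (simp only: dist_fls_eq two_powi_eq_powr if_False)
  with False show ?thesis
    by (simp only: mem_agree_below_iff minus_le_iff) simp
qed (use assms in simp)

text \<open>An integer lies strictly below \<open>log 2 r\<close> iff it lies strictly below its
  ceiling; making the strict integer bound weak produces the summand 1.\<close>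

lemma fls_dist_less_iff:
  fixes x y :: "real fls"
  assumes "r > 0"
  shows "dist x y < r \<longleftrightarrow> y \<in> agree_below (1 - \<lceil>log 2 r\<rceil>) x"
proof (cases "x = y")
  case False
  have "dist x y < r \<longleftrightarrow> - fls_subdegree (x - y) < \<lceil>log 2 r\<rceil>"
    unfolding less_ceiling_iff less_log_iff[OF _ assms, of 2, simplified]
    using False by (simp only: dist_fls_eq two_powi_eq_powr if_False)
  with False show ?thesis
    by (auto simp only: mem_agree_below_iff)
qed (use assms in simp)

lemma fls_cball_eq:
  fixes x :: "real fls"
  shows "r > 0 \<Longrightarrow> cball x r = agree_below (- \<lfloor>log 2 r\<rfloor>) x"
  by (auto simp: fls_dist_le_iff)

lemma fls_ball_eq:
  fixes x :: "real fls"
  shows "r > 0 \<Longrightarrow> ball x r = agree_below (1 - \<lceil>log 2 r\<rceil>) x"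
  by (auto simp: fls_dist_less_iff)

lemma open_agree_below: "open (agree_below n (x :: real fls))"
  \<comment> \<open>The radius solves \<open>1 - \<lceil>log 2 r\<rceil> = n\<close>.\<close>
  using open_ball[of x "2 powi (1 - n)"] fls_ball_eq[of "2 powi (1 - n)" x]
  by (simp add: log2_powi)

lemma closed_agree_below: "closed (agree_below n (x :: real fls))"
  using closed_cball[of x "2 powi (- n)"] fls_cball_eq[of "2 powi (- n)" x]
  by (simp add: log2_powi)

lemma open_imp_agree_below_subset:
  fixes x :: "real fls"
  assumes "open U" "x \<in> U"
  obtains n where "agree_below n x \<subseteq> U"
  using assms by (metis fls_ball_eq open_contains_ball)

section \<open>Spherical completeness\<close>

lemma Inter_chain_agree_below:
  fixes \<C> :: "'a::zero fls set set"
  assumes balls: "\<And>B. B \<in> \<C> \<Longrightarrow> \<exists>n x. B = agree_below n x"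
    and chain: "\<And>A B. A \<in> \<C> \<Longrightarrow> B \<in> \<C> \<Longrightarrow> A \<subseteq> B \<or> B \<subseteq> A"
  shows "\<Inter>\<C> \<noteq> {}"
proof (cases "\<C> = {}")
  case False
  \<comment> \<open>\<open>P i c\<close> says that some member of the chain prescribes the entry
    \<open>c\<close> at index \<open>i\<close>; where nothing is prescribed, \<open>f\<close> takes
    the default 0.\<close>
  define P where "P i c \<longleftrightarrow> (\<exists>n x. agree_below n x \<in> \<C> \<and> i < n \<and> c = x $$ i)" for i c
  define f where "f i = (if \<exists>c. P i c then SOME c. P i c else 0)" for i
  have unique: "c = c'" if P: "P i c" "P i c'" for i c c'
  proof -
    obtain n x m y where
      x: "agree_below n x \<in> \<C>" "i < n" "c = x $$ i" and
      y: "agree_below m y \<in> \<C>" "i < m" "c' = y $$ i"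
      using P unfolding P_def by blast
    \<comment> \<open>The centre of the smaller set lies in the larger one, so the centres agree
      below the cutoff of the larger set, in particular at \<open>i\<close>.\<close>
    have "x \<in> agree_below m y \<or> y \<in> agree_below n x"
      using chain[OF x(1) y(1)] agree_below_refl by blast
    then show ?thesis
      using x y by (auto simp: agree_below_def)
  qed
  have f: "f i = x $$ i" if "agree_below n x \<in> \<C>" "i < n" for n x i
  proof -
    have "P i (x $$ i)" using that by (auto simp: P_def)
    then show ?thesis using unique by (metis f_def someI)
  qed
  obtain n x where nx: "agree_below n x \<in> \<C>"
    using balls False by blast
  \<comment> \<open>A single member of the chain already makes \<open>f\<close> vanish far to the
    left, so \<open>f\<close> really is the coefficient sequence of a Laurent series.\<close>
  have "\<forall>i < min n (fls_subdegree x). f i = 0"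
    using f[OF nx] by simp
  then have nth: "Abs_fls f $$ i = f i" for i
    by (rule nth_Abs_fls_lower_bound)
  have "Abs_fls f \<in> B" if B: "B \<in> \<C>" for B
  proof -
    obtain m y where "B = agree_below m y" using balls B by blast
    with B f nth show ?thesis by (simp add: agree_below_def)
  qed
  then show ?thesis by blast
qed simp

lemma ultrametric_valuation_metric: "ultrametric valuation_metric"
proof -
  have "dist x z \<le> max (dist x y) (dist y z)" for x y z :: "real fls"
  proof (cases "x = y")
    case False
    \<comment> \<open>With this radius, positive since \<open>x \<noteq> y\<close>, the inequality
      becomes transitivity of agreement below one common index.\<close>
    define r where "r = max (dist x y) (dist y z)"
    have "r > 0" "dist x y \<le> r" "dist y z \<le> r"
      using False by (auto simp: r_def less_max_iff_disj)
    then have "dist x z \<le> r"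
      by (auto simp: fls_dist_le_iff agree_below_def)
    then show ?thesis by (simp add: r_def)
  qed simp
  then show ?thesis
    by (simp add: ultrametric_def valuation_metric_def)
qed

lemma metric_ball_eq_agree_below:
  assumes "B \<in> metric_balls valuation_metric"
  shows "\<exists>n x. B = agree_below n x"
proof -
  obtain x r where "r > 0" "B = ball x r \<or> B = cball x r"
    using assms
    by (auto simp: metric_balls_def valuation_metric_def mball_of_def mcball_of_def)
  then show ?thesis
    using fls_ball_eq fls_cball_eq by blast
qed

lemma spherically_complete_valuation_metric: "spherically_complete valuation_metric"
  unfolding spherically_complete_def
proof (intro conjI allI impI)
  fix \<C> assume "\<C> \<noteq> {} \<and> \<C> \<in> chains (metric_balls valuation_metric)"
  then show "\<Inter>\<C> \<noteq> {}"
    by (intro Inter_chain_agree_below metric_ball_eq_agree_below)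
       (auto simp: chains_def chain_subset_def)
qed (rule ultrametric_valuation_metric)

section \<open>Topology of the valuation metric\<close>

lemma valuation_topology_eq_euclidean: "\<tau>\<^sub>v = euclidean"
  by (simp add: valuation_topology_def valuation_metric_def)

text \<open>The sets \<open>agree_below n x\<close> serve as base: each is an open ball and also a
  closed ball, hence clopen.\<close>

lemma zero_dimensional_valuation_topology: "zero_dimensional_space \<tau>\<^sub>v"
  unfolding zero_dimensional_space_def valuation_topology_eq_euclidean
proof (intro exI[of _ "{agree_below n x | n x. True}"] conjI allI impI ballI)
  fix U and x :: "real fls"
  assume "openin euclidean U \<and> x \<in> U"
  then obtain n where "agree_below n x \<subseteq> U"
    using open_imp_agree_below_subset[of U x] by auto
  then show "\<exists>V\<in>{agree_below n x | n x. True}. x \<in> V \<and> V \<subseteq> U"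
    using agree_below_refl by blast
next
  fix V :: "real fls set"
  assume "V \<in> {agree_below n x | n x. True}"
  then obtain n x where "V = agree_below n x" by blast
  then show "openin euclidean V" "closedin euclidean V"
    by (simp_all add: open_agree_below closed_agree_below)
qed

text \<open>The shifted constants are the monomials with coefficients \<open>a\<close> and
  \<open>b\<close> in degree \<open>n\<close>; they can differ only at index \<open>n\<close>, which
  is prescribed only if \<open>n < m\<close>.\<close>

lemma fls_monomial_agree_below_iff:
  fixes a b :: real
  shows "fls_shift (- n) (fls_const b) \<in> agree_below m (fls_shift (- n) (fls_const a)) \<longleftrightarrow>
    m \<le> n \<or> a = b"
  by (auto simp: agree_below_def)

text \<open>The monomials of degree \<open>n\<close> form an infinite uniformly discrete, hence
  closed, subset of the ball, whereas a closed discrete subset of a compact set is finite.\<close>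

lemma not_compact_superset_agree_below:
  fixes K :: "real fls set"
  assumes "compact K"
  shows "\<not> agree_below n 0 \<subseteq> K"
proof
  assume sub: "agree_below n 0 \<subseteq> K"
  define g :: "real \<Rightarrow> real fls" where "g a = fls_shift (- n) (fls_const a)" for a
  define S where "S = range g"
  have "S \<subseteq> K"
    using sub by (auto simp: S_def g_def agree_below_def)
  \<comment> \<open>Being strictly closer than \<open>2 powi (- n)\<close> forces agreement below
    \<open>n + 1\<close>, hence also at index \<open>n\<close>, where a monomial carries its
    coefficient.\<close>
  have "x = y" if "x \<in> S" "y \<in> S" "dist x y < 2 powi (- n)" for x y
  proof -
    have "y \<in> agree_below (n + 1) x"
      using that(3) fls_dist_less_iff[of "2 powi (- n)" x y]
      by (simp add: log2_powi ceiling_minus add.commute)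
    then show ?thesis
      using that(1,2) fls_monomial_agree_below_iff[of n _ "n + 1"] by (auto simp: S_def g_def)
  qed
  then have "uniform_discrete S"
    by (intro uniformI1[of "2 powi (- n)"]) auto
  then have "closed S" "discrete S"
    by (rule uniform_discrete_imp_closed, rule uniform_discrete_imp_discrete)
  moreover from \<open>closed S\<close> \<open>compact K\<close> \<open>S \<subseteq> K\<close> have "compact S"
    by (metis compact_Int_closed inf.absorb2)
  ultimately have "finite S"
    using discrete_compact_finite_iff by blast
  moreover have "inj g"
    using fls_monomial_agree_below_iff[of n _ "n + 1"]
    by (metis (no_types) agree_below_refl add_le_same_cancel1 g_def injI not_one_le_zero)
  ultimately show False
    using infinite_UNIV_char_0 finite_imageD unfolding S_def by blast
qed

lemma not_locally_compact_valuation_topology: "\<not> locally_compact_space \<tau>\<^sub>v"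
proof
  assume "locally_compact_space \<tau>\<^sub>v"
  then have "\<exists>U K. openin euclidean U \<and> compactin euclidean K \<and> 0 \<in> U \<and> U \<subseteq> (K :: real fls set)"
    unfolding locally_compact_space_def valuation_topology_eq_euclidean topspace_euclidean
    by (rule bspec) (rule UNIV_I)
  then obtain U K :: "real fls set" where UK: "open U" "compact K" "0 \<in> U" "U \<subseteq> K"
    unfolding compactin_euclidean_iff open_openin[symmetric] by blast
  then obtain n where "agree_below n 0 \<subseteq> U"
    using open_imp_agree_below_subset by blast
  with UK not_compact_superset_agree_below show False by blast
qed

text \<open>Picking a basic set around each real constant, small enough to fix the entry at index 0,
  injects the reals into the base.\<close>

lemma not_second_countable_valuation_topology: "\<not> second_countable \<tau>\<^sub>v"
proof
  assume "second_countable \<tau>\<^sub>v"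
  then obtain \<B> :: "real fls set set" where \<B>: "countable \<B>"
    "\<forall>U x. open U \<and> x \<in> U \<longrightarrow> (\<exists>V\<in>\<B>. x \<in> V \<and> V \<subseteq> U)"
    unfolding second_countable_def valuation_topology_eq_euclidean open_openin[symmetric]
    by (elim exE conjE) (rule that)
  have "\<exists>V\<in>\<B>. fls_const a \<in> V \<and> V \<subseteq> agree_below 1 (fls_const a)" for a
    using \<B>(2) open_agree_below by simp
  then obtain V where V: "\<And>a. V a \<in> \<B>" "\<And>a. fls_const a \<in> V a"
    "\<And>a. V a \<subseteq> agree_below 1 (fls_const a)"
    by metis
  have "inj V"
  proof (rule injI)
    fix a b assume "V a = V b"
    then have "fls_const b \<in> agree_below 1 (fls_const a)"
      using V by blast
    then show "a = b"
      using fls_monomial_agree_below_iff[of 0 b 1 a] by simp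
  qed
  moreover have "countable (range V)"
    using \<B>(1) V(1) by (metis countable_subset image_subsetI)
  ultimately have "countable (UNIV :: real set)"
    using countable_image_inj_on by blast
  then show False
    using uncountable_UNIV_real by blast
qed

section \<open>The standard topology\<close>

lemma zero_in_finite_elements: "0 \<in> \<F>"
  unfolding finite_elements_def mem_Collect_eq by (rule exI[of _ 1]) simp

lemma fls_X_in_finite_elements: "fls_X \<in> \<F>"
proof -
  \<comment> \<open>The leading entry of \<open>1 - fls_X\<close> is thus the 1 at index 0, which is
    positive.\<close>
  have "fls_subdegree (1 - fls_X :: real fls) = 0"
    by (rule fls_subdegree_eqI) auto
  then have "(fls_X :: real fls) < 1"
    by (auto simp: less_fls_def fls_eq_iff)
  moreover have "(0 :: real fls) < fls_X"
    by (simp add: less_fls_def)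
  ultimately show ?thesis
    unfolding finite_elements_def mem_Collect_eq by (intro exI[of _ 1]) simp
qed

text \<open>Points with equal standard part have pseudo-distance 0, so every ball around one
  contains the other.\<close>

lemma openin_standard_topology_St_eq:
  assumes "openin \<tau>\<^sub>S\<^sub>t U" "x \<in> U" "y \<in> \<F>" "St x = St y"
  shows "y \<in> U"
proof -
  obtain r where "r > 0" "{y \<in> \<F>. \<bar>St x - St y\<bar> < r} \<subseteq> U"
    using assms(1,2) unfolding standard_topology_def openin_pseudometric_topology by blast
  with assms(3,4) show ?thesis by auto
qed

lemma openin_standard_topology_vimage:
  assumes "open A"
  shows "openin \<tau>\<^sub>S\<^sub>t {x \<in> \<F>. St x \<in> A}"
  unfolding standard_topology_def openin_pseudometric_topology
proof (intro conjI ballI)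
  fix x assume "x \<in> {x \<in> \<F>. St x \<in> A}"
  then obtain r where "r > 0" "\<forall>t. dist (St x) t < r \<longrightarrow> t \<in> A"
    using assms by (auto simp: open_dist dist_commute)
  then show "\<exists>r>0. {y \<in> \<F>. \<bar>St x - St y\<bar> < r} \<subseteq> {x \<in> \<F>. St x \<in> A}"
    by (intro exI[of _ r]) (simp add: dist_real_def subset_eq)
qed blast

lemma topspace_standard_topology: "topspace \<tau>\<^sub>S\<^sub>t = \<F>"
  by (simp add: standard_topology_def)

lemma not_Hausdorff_standard_topology: "\<not> Hausdorff_space \<tau>\<^sub>S\<^sub>t"
proof
  assume "Hausdorff_space \<tau>\<^sub>S\<^sub>t"
  then obtain U V where "openin \<tau>\<^sub>S\<^sub>t U" "0 \<in> U" "fls_X \<in> V" "disjnt U V"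
    using zero_in_finite_elements fls_X_in_finite_elements
    by (metis Hausdorff_space_def topspace_standard_topology fls_X_nonzero)
  moreover from this have "fls_X \<in> U"
    using openin_standard_topology_St_eq fls_X_in_finite_elements by (force simp: St_def)
  ultimately show False by (auto simp: disjnt_iff)
qed

lemma preregular_standard_topology: "preregular_space \<tau>\<^sub>S\<^sub>t"
  unfolding preregular_space_def topspace_standard_topology
proof (intro ballI impI)
  fix x y
  assume xy: "x \<in> \<F>" "y \<in> \<F>" and "\<exists>W. openin \<tau>\<^sub>S\<^sub>t W \<and> (x \<in> W \<longleftrightarrow> y \<notin> W)"
  then obtain W where W: "openin \<tau>\<^sub>S\<^sub>t W" "x \<in> W \<longleftrightarrow> y \<notin> W" by blast
  \<comment> \<open>Otherwise \<open>W\<close> would contain both points or neither; saturation is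
    used in both directions as either point may be the one in \<open>W\<close>.\<close>
  have "St x \<noteq> St y"
    using W(2) openin_standard_topology_St_eq[OF W(1), of x y]
      openin_standard_topology_St_eq[OF W(1), of y x] xy by argo
  then obtain A B where "open A" "open B" "St x \<in> A" "St y \<in> B" "A \<inter> B = {}"
    using hausdorff[of "St x" "St y"] by metis
  with xy show "\<exists>U V. openin \<tau>\<^sub>S\<^sub>t U \<and> openin \<tau>\<^sub>S\<^sub>t V \<and> x \<in> U \<and> y \<in> V \<and> disjnt U V"
    by (intro exI[of _ "{x \<in> \<F>. St x \<in> A}"] exI[of _ "{x \<in> \<F>. St x \<in> B}"])
       (auto simp: openin_standard_topology_vimage disjnt_def)
qed

theorem theorem4p1:
  shows "(\<not> Hausdorff_space \<tau>\<^sub>S\<^sub>t \<and> preregular_space \<tau>\<^sub>S\<^sub>t) \<and>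
    (Hausdorff_space \<tau>\<^sub>v \<and> first_countable \<tau>\<^sub>v \<and> zero_dimensional_space \<tau>\<^sub>v \<and>
     spherically_complete valuation_metric \<and>
     \<not> locally_compact_space \<tau>\<^sub>v \<and> \<not> second_countable \<tau>\<^sub>v)"
proof -
  have "metrizable_space \<tau>\<^sub>v"
    by (simp add: valuation_topology_eq_euclidean metrizable_space_euclidean)
  then have "Hausdorff_space \<tau>\<^sub>v" "first_countable \<tau>\<^sub>v"
    by (simp_all add: metrizable_imp_Hausdorff_space metrizable_imp_first_countable)
  then show ?thesis
    using not_Hausdorff_standard_topology preregular_standard_topology
      zero_dimensional_valuation_topology spherically_complete_valuation_metric
      not_locally_compact_valuation_topology not_second_countable_valuation_topology
    by blast
qed

end
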